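(* Let $d\in\mathbb{N}$. Every polynomial $p\in\mathbb{C}\langle x_1,\dots,x_d\rangle$ has a linearization. If moreover $p=p^*$, then $p$ has a linearization $\hat p$ which is selfadjoint, i.e. $\hat p=\hat p^*$.
   Context: $\mathbb{C}\langle x_1,\dots,x_d\rangle$ is the unital complex algebra of polynomials in $d$ non-commuting indeterminates, made into a $*$-algebra by $x_i^*=x_i$ (so $*$ is conjugate-linear and reverses products). For a matrix $a=(a_{ij})$ over $\mathbb{C}\langle x_1,\dots,x_d\rangle$, $a^*$ is the matrix with $(i,j)$-entry $a_{ji}^*$. A linearization of $p\in\mathbb{C}\langle x_1,\dots,x_d\rangle$ is a matrix $$\hat p=\begin{pmatrix}0&u\\ v&q\end{pmatrix}\in M_n(\mathbb{C}\langle x_1,\dots,x_d\rangle)$$ for some $n\in\mathbb{N}$, where $q\in M_{n-1}(\mathbb{C}\langle x_1,\dots,x_d\rangle)$ is invertible as a matrix over $\mathbb{C}\langle x_1,\dots,x_d\rangle$, $u\in M_{1,n-1}(\mathbb{C}\langle x_1,\dots,x_d\rangle)$ is a row and $v\in M_{n-1,1}(\mathbb{C}\langle x_1,\dots,x_d\rangle)$ is a column, such that (i) $\hat p$ is affine in $x_1,\dots,x_d$, i.e. there are $b_0,b_1,\dots,b_d\in M_n(\mathbb{C})$ with $\hat p=b_0\otimes 1+b_1\otimes x_1+\cdots+b_d\otimes x_d$; and (ii) $p=-uq^{-1}v$. *)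

theory Defs
  imports "HOL-Library.Poly_Mapping" "Jordan_Normal_Form.Matrix" Complex_Main
begin

text \<open>Words form the free monoid under concatenation. It is written additively because the
  convolution product of \<^type>\<open>poly_mapping\<close> expects an additive (not necessarily commutative)
  monoid of exponents.\<close>

instantiation list :: (type) monoid_add
begin

definition zero_list :: "'a list" where "zero_list = []"

definition plus_list :: "'a list \<Rightarrow> 'a list \<Rightarrow> 'a list" where "plus_list = (@)"

instance
  by standard (simp_all add: zero_list_def plus_list_def)

end

text \<open>A noncommutative polynomial is a finitely supported family of coefficients indexed by words.
  The type has the indeterminates \<open>x\<^sub>i\<close> for all natural numbers \<open>i\<close>; the algebra in
  \<open>x\<^sub>1, \<dots>, x\<^sub>d\<close> is the subset \<open>ncpolys d\<close>.\<close>

type_synonym ncpoly = "nat list \<Rightarrow>\<^sub>0 complex"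

definition nc_const :: "complex \<Rightarrow> ncpoly" where
  "nc_const c = Poly_Mapping.single [] c"

definition nc_var :: "nat \<Rightarrow> ncpoly" where
  "nc_var i = Poly_Mapping.single [i] 1"

definition ncpolys :: "nat \<Rightarrow> ncpoly set" where
  "ncpolys d = {p. \<forall>w \<in> Poly_Mapping.keys p. set w \<subseteq> {1..d}}"

definition ncstar :: "ncpoly \<Rightarrow> ncpoly" where
  "ncstar p = Poly_Mapping.map cnj (Poly_Mapping.map_key rev p)"

definition ncstar_mat :: "ncpoly mat \<Rightarrow> ncpoly mat" where
  "ncstar_mat A = map_mat ncstar (transpose_mat A)"

definition ncmats :: "nat \<Rightarrow> nat \<Rightarrow> nat \<Rightarrow> ncpoly mat set" where
  "ncmats d m n = {A \<in> carrier_mat m n. elements_mat A \<subseteq> ncpolys d}"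

definition affine_ncmat :: "nat \<Rightarrow> nat \<Rightarrow> ncpoly mat \<Rightarrow> bool" where
  "affine_ncmat d n P \<longleftrightarrow>
     (\<exists>b :: nat \<Rightarrow> complex mat. (\<forall>k \<le> d. b k \<in> carrier_mat n n) \<and>
        P = mat n n (\<lambda>(i, j). nc_const (b 0 $$ (i, j)) +
              (\<Sum>k = 1..d. nc_const (b k $$ (i, j)) * nc_var k)))"

text \<open>Here \<open>r\<close> is the inverse of \<open>q\<close>; it is unique when it exists, and for \<open>n = 1\<close> the
  blocks \<open>u\<close>, \<open>v\<close>, \<open>q\<close> are empty. Invertibility is meant in the matrices over the
  algebra in \<open>x\<^sub>1, \<dots>, x\<^sub>d\<close>, so \<open>r\<close> is required to have its entries there.\<close>

definition is_linearization :: "nat \<Rightarrow> ncpoly \<Rightarrow> ncpoly mat \<Rightarrow> bool" where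
  "is_linearization d p P \<longleftrightarrow>
     (\<exists>n u v q r. 1 \<le> n \<and> P \<in> ncmats d n n \<and>
        u \<in> ncmats d 1 (n - 1) \<and> v \<in> ncmats d (n - 1) 1 \<and> q \<in> ncmats d (n - 1) (n - 1) \<and>
        P = four_block_mat (0\<^sub>m 1 1) u v q \<and>
        r \<in> ncmats d (n - 1) (n - 1) \<and> inverts_mat q r \<and> inverts_mat r q \<and>
        affine_ncmat d n P \<and>
        p = (- (u * r * v)) $$ (0, 0))"

text \<open>The operation \<^const>\<open>ncstar\<close> is the unique conjugate-linear anti-automorphism fixing
  the indeterminates.\<close>

lemma lookup_ncstar:
  "Poly_Mapping.lookup (ncstar p) w = cnj (Poly_Mapping.lookup p (rev w))"
  by (simp add: ncstar_def Poly_Mapping.map.rep_eq Poly_Mapping.map_key.rep_eq when_def)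

lemma ncstar_single:
  "ncstar (Poly_Mapping.single w c) = Poly_Mapping.single (rev w) (cnj c)"
  by (rule poly_mapping_eqI) (auto simp: lookup_ncstar lookup_single when_def)

lemma ncstar_const: "ncstar (nc_const c) = nc_const (cnj c)"
  by (simp add: nc_const_def ncstar_single)

lemma ncstar_var: "ncstar (nc_var i) = nc_var i"
  by (simp add: nc_var_def ncstar_single)

lemma ncstar_add: "ncstar (p + q) = ncstar p + ncstar q"
  by (rule poly_mapping_eqI) (simp add: lookup_ncstar lookup_add)

lemma ncstar_ncstar: "ncstar (ncstar p) = p"
  by (rule poly_mapping_eqI) (simp add: lookup_ncstar)

lemma ncstar_sum: "ncstar (sum f A) = (\<Sum>a\<in>A. ncstar (f a))"
  by (rule poly_mapping_eqI) (simp add: lookup_ncstar lookup_sum)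

lemma ncpoly_sum_single:
  "(p :: ncpoly) = (\<Sum>w\<in>Poly_Mapping.keys p. Poly_Mapping.single w (Poly_Mapping.lookup p w))"
  by (rule poly_mapping_eqI)
     (auto simp: lookup_sum lookup_single when_def sum.delta in_keys_iff)

lemma ncstar_mult: "ncstar (p * q) = ncstar q * ncstar p"
proof -
  have "ncstar ((\<Sum>w\<in>A. Poly_Mapping.single w (f w)) * (\<Sum>w\<in>B. Poly_Mapping.single w (g w))) =
      ncstar (\<Sum>w\<in>B. Poly_Mapping.single w (g w)) * ncstar (\<Sum>w\<in>A. Poly_Mapping.single w (f w))"
    for A B f g
    unfolding sum_product ncstar_sum mult_single ncstar_single plus_list_def
    by (subst sum.swap) (simp add: mult.commute)
  from this[where A = "Poly_Mapping.keys p" and f = "Poly_Mapping.lookup p"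
      and B = "Poly_Mapping.keys q" and g = "Poly_Mapping.lookup q"]
  show ?thesis
    by (simp only: ncpoly_sum_single[of p, symmetric] ncpoly_sum_single[of q, symmetric])
qed

text \<open>The subset \<^const>\<open>ncpolys\<close> is a unital \<open>*\<close>-subalgebra containing its indeterminates.\<close>

lemma nc_const_in_ncpolys: "nc_const c \<in> ncpolys d"
  by (simp add: ncpolys_def nc_const_def)

lemma one_in_ncpolys: "1 \<in> ncpolys d"
  by (simp add: ncpolys_def zero_list_def)

lemma nc_var_in_ncpolys: "i \<in> {1..d} \<Longrightarrow> nc_var i \<in> ncpolys d"
  by (simp add: ncpolys_def nc_var_def)

lemma add_in_ncpolys: "p \<in> ncpolys d \<Longrightarrow> q \<in> ncpolys d \<Longrightarrow> p + q \<in> ncpolys d"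
  unfolding ncpolys_def using Poly_Mapping.keys_add[of p q] by blast

lemma mult_in_ncpolys: "p \<in> ncpolys d \<Longrightarrow> q \<in> ncpolys d \<Longrightarrow> p * q \<in> ncpolys d"
proof -
  assume pq: "p \<in> ncpolys d" "q \<in> ncpolys d"
  have "set w \<subseteq> {1..d}" if "w \<in> Poly_Mapping.keys (p * q)" for w
  proof -
    from that keys_mult[of p q] obtain a b
      where "w = a @ b" "a \<in> Poly_Mapping.keys p" "b \<in> Poly_Mapping.keys q"
      unfolding plus_list_def by blast
    with pq show ?thesis by (simp add: ncpolys_def)
  qed
  then show ?thesis by (simp add: ncpolys_def)
qed

lemma ncstar_in_ncpolys: "p \<in> ncpolys d \<Longrightarrow> ncstar p \<in> ncpolys d"
proof -
  assume p: "p \<in> ncpolys d"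
  have "set w \<subseteq> {1..d}" if "w \<in> Poly_Mapping.keys (ncstar p)" for w
  proof -
    from that have "rev w \<in> Poly_Mapping.keys p"
      by (simp add: in_keys_iff lookup_ncstar)
    with p have "set (rev w) \<subseteq> {1..d}" by (simp only: ncpolys_def mem_Collect_eq)
    then show ?thesis by simp
  qed
  then show ?thesis by (simp add: ncpolys_def)
qed

end

theory Submission
  imports Defs
begin

text \<open>A realization of \<open>p\<close> is a triple \<open>u, q, v\<close> of affine matrices with \<open>q\<close> invertible and
  \<open>u q\<^sup>-\<^sup>1 v = p\<close>; a linearization of \<open>p\<close> is the same thing as a realization of \<open>- p\<close>. Constants have
  a realization of size one. Sums are realized by block diagonal \<open>q\<close>, and if \<open>u, q, v\<close> realizes
  \<open>p\<close>, then \<open>x p\<close> is realized by the row \<open>(x, 0)\<close>, the block matrix with rows \<open>(1, -u)\<close> and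
  \<open>(0, q)\<close>, and the column \<open>(0, v)\<close>. If \<open>p\<close> is selfadjoint and \<open>u, q, v\<close> realizes \<open>- p / 2\<close>, then
  the row \<open>(u, v\<^sup>*)\<close>, the block matrix with rows \<open>(0, q\<^sup>*)\<close> and \<open>(q, 0)\<close>, and the column
  \<open>(u\<^sup>*, v)\<close> realize \<open>- p / 2 + (- p / 2)\<^sup>* = - p\<close>.\<close>

section \<open>Block matrices\<close>

text \<open>The entry set is a parameter so that the same closure lemmas serve both the affine
  polynomials and the whole algebra.\<close>

definition mats_over :: "'a set \<Rightarrow> nat \<Rightarrow> nat \<Rightarrow> 'a mat set" where
  "mats_over S m n = {A \<in> carrier_mat m n. elements_mat A \<subseteq> S}"

lemma ncmats_eq_mats_over: "ncmats d = mats_over (ncpolys d)"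
  by (intro ext) (simp add: ncmats_def mats_over_def)

lemma mats_over_carrier: "A \<in> mats_over S m n \<Longrightarrow> A \<in> carrier_mat m n"
  by (simp add: mats_over_def)

lemma mats_over_mono: "A \<in> mats_over S m n \<Longrightarrow> S \<subseteq> T \<Longrightarrow> A \<in> mats_over T m n"
  by (auto simp: mats_over_def)

lemma mats_over_iff:
  "A \<in> mats_over S m n \<longleftrightarrow> A \<in> carrier_mat m n \<and> (\<forall>i<m. \<forall>j<n. A $$ (i, j) \<in> S)"
  by (auto simp: mats_over_def dest!: elements_matD)

lemma four_block_in_mats_over:
  assumes "A \<in> mats_over S m1 n1" "B \<in> mats_over S m1 n2"
    "C \<in> mats_over S m2 n1" "D \<in> mats_over S m2 n2"
  shows "four_block_mat A B C D \<in> mats_over S (m1 + m2) (n1 + n2)"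
  using assms elements_four_block_mat[of A m1 n1 B n2 C m2 D]
  unfolding mats_over_def by (auto dest!: subsetD)

lemma zero_in_mats_over: "0 \<in> S \<Longrightarrow> 0\<^sub>m m n \<in> mats_over S m n"
  by (simp add: mats_over_iff)

lemma one_in_mats_over: "0 \<in> S \<Longrightarrow> 1 \<in> S \<Longrightarrow> 1\<^sub>m n \<in> mats_over S n n"
  by (simp add: mats_over_iff)

lemma mult_in_mats_over:
  assumes "A \<in> mats_over S m k" "B \<in> mats_over S k n" "0 \<in> S"
    and "\<And>a b. a \<in> S \<Longrightarrow> b \<in> S \<Longrightarrow> a + b \<in> S" "\<And>a b. a \<in> S \<Longrightarrow> b \<in> S \<Longrightarrow> a * b \<in> S"
  shows "A * B \<in> mats_over S m n"
proof -
  have sum: "sum f I \<in> S" if "\<And>i. i \<in> I \<Longrightarrow> f i \<in> S" for f :: "nat \<Rightarrow> 'a" and I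
    using that assms(3,4) by (induction I rule: infinite_finite_induct) auto
  show ?thesis
    using assms(1,2)
    by (auto simp: mats_over_iff scalar_prod_def intro!: sum assms(5))
qed

text \<open>The lower blocks have height zero, dual to the zero-width right blocks of
  \<open>@\<^sub>r\<close>, so that rows and columns of blocks multiply by
  \<open>mult_four_block_mat\<close>.\<close>

definition block_row :: "'a::zero mat \<Rightarrow> 'a mat \<Rightarrow> 'a mat" where
  "block_row A B = four_block_mat A B (0\<^sub>m 0 (dim_col A)) (0\<^sub>m 0 (dim_col B))"

lemma block_row_in_mats_over:
  assumes "A \<in> mats_over S m n1" "B \<in> mats_over S m n2"
  shows "block_row A B \<in> mats_over S m (n1 + n2)"
  using assms by (auto simp: mats_over_iff block_row_def)

lemma append_rows_in_mats_over:
  assumes "A \<in> mats_over S m1 n" "B \<in> mats_over S m2 n"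
  shows "A @\<^sub>r B \<in> mats_over S (m1 + m2) n"
  using assms by (auto simp: mats_over_iff append_rows_def)

text \<open>Evaluates the value \<open>u * r * v\<close> in each of the three block constructions
  below.\<close>

lemma block_row_mult_append_rows:
  fixes A :: "'a::ring_1 mat"
  assumes u: "u1 \<in> carrier_mat a m1" "u2 \<in> carrier_mat a m2"
    and q: "A \<in> carrier_mat m1 n1" "B \<in> carrier_mat m1 n2"
      "C \<in> carrier_mat m2 n1" "D \<in> carrier_mat m2 n2"
    and v: "v1 \<in> carrier_mat n1 b" "v2 \<in> carrier_mat n2 b"
  shows "block_row u1 u2 * four_block_mat A B C D * (v1 @\<^sub>r v2) =
    (u1 * A + u2 * C) * v1 + (u1 * B + u2 * D) * v2"
proof -
  have "block_row u1 u2 * four_block_mat A B C D =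
      four_block_mat (u1 * A + u2 * C) (u1 * B + u2 * D) (0\<^sub>m 0 n1) (0\<^sub>m 0 n2)"
    unfolding block_row_def
    using u q by (subst mult_four_block_mat[of _ a m1 _ m2 _ 0 _ _ n1 _ n2]) auto
  also have "\<dots> * (v1 @\<^sub>r v2) = four_block_mat
      ((u1 * A + u2 * C) * v1 + (u1 * B + u2 * D) * v2) (0\<^sub>m a 0) (0\<^sub>m 0 b) (0\<^sub>m 0 0)"
    unfolding append_rows_def
    using u q v by (subst mult_four_block_mat[of _ a n1 _ n2 _ 0 _ _ b _ 0]) auto
  \<comment> \<open>The other three blocks have no entries, so only the upper left one
    remains.\<close>
  also have "\<dots> = (u1 * A + u2 * C) * v1 + (u1 * B + u2 * D) * v2"
    using u q v by (intro eq_matI) auto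
  finally show ?thesis .
qed

section \<open>Adjoints of matrices\<close>

lemma ncstar_0: "ncstar 0 = 0"
  by (rule poly_mapping_eqI) (simp add: lookup_ncstar)

lemma ncstar_1: "ncstar 1 = 1"
  using ncstar_const[of 1] by (simp add: nc_const_def zero_list_def flip: single_one)

lemma ncstar_mat_carrier: "A \<in> carrier_mat m n \<Longrightarrow> ncstar_mat A \<in> carrier_mat n m"
  by (simp add: ncstar_mat_def)

lemma ncstar_mat_dim: "dim_row (ncstar_mat A) = dim_col A" "dim_col (ncstar_mat A) = dim_row A"
  by (simp_all add: ncstar_mat_def)

lemma ncstar_mat_index:
  "i < dim_col A \<Longrightarrow> j < dim_row A \<Longrightarrow> ncstar_mat A $$ (i, j) = ncstar (A $$ (j, i))"
  by (simp add: ncstar_mat_def)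

lemma ncstar_mat_in_mats_over:
  assumes "A \<in> mats_over S m n" "\<And>a. a \<in> S \<Longrightarrow> ncstar a \<in> S"
  shows "ncstar_mat A \<in> mats_over S n m"
  using assms by (auto simp: mats_over_iff ncstar_mat_index ncstar_mat_carrier)

lemma ncstar_mat_ncstar_mat: "ncstar_mat (ncstar_mat A) = A"
  by (rule eq_matI) (simp_all add: ncstar_mat_dim ncstar_mat_index ncstar_ncstar)

lemma ncstar_mat_zero: "ncstar_mat (0\<^sub>m m n) = 0\<^sub>m n m"
  by (rule eq_matI) (simp_all add: ncstar_mat_dim ncstar_mat_index ncstar_0)

lemma ncstar_mat_one: "ncstar_mat (1\<^sub>m n) = 1\<^sub>m n"
  by (rule eq_matI) (auto simp add: ncstar_mat_dim ncstar_mat_index ncstar_0 ncstar_1)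

text \<open>Over noncommuting entries transposition alone does not reverse products; the reversal by
  \<open>ncstar\<close> inside each entry makes the two sums agree.\<close>

lemma ncstar_mat_mult:
  assumes "dim_col A = dim_row B"
  shows "ncstar_mat (A * B) = ncstar_mat B * ncstar_mat A"
  using assms
  by (intro eq_matI)
     (auto simp: ncstar_mat_dim ncstar_mat_index scalar_prod_def ncstar_sum ncstar_mult)

lemma ncstar_mat_four_block:
  assumes "A \<in> carrier_mat m1 n1" "B \<in> carrier_mat m1 n2"
    "C \<in> carrier_mat m2 n1" "D \<in> carrier_mat m2 n2"
  shows "ncstar_mat (four_block_mat A B C D) =
    four_block_mat (ncstar_mat A) (ncstar_mat C) (ncstar_mat B) (ncstar_mat D)"
  using assms by (intro eq_matI) (auto simp: ncstar_mat_dim ncstar_mat_index)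

lemma ncstar_mat_block_row:
  assumes "A \<in> carrier_mat m n1" "B \<in> carrier_mat m n2"
  shows "ncstar_mat (block_row A B) = ncstar_mat A @\<^sub>r ncstar_mat B"
  using assms unfolding block_row_def append_rows_def
  by (subst ncstar_mat_four_block) (auto simp: ncstar_mat_zero ncstar_mat_dim)

lemma ncstar_mat_append_rows:
  assumes "A \<in> carrier_mat m1 n" "B \<in> carrier_mat m2 n"
  shows "ncstar_mat (A @\<^sub>r B) = block_row (ncstar_mat A) (ncstar_mat B)"
  using assms unfolding block_row_def append_rows_def
  by (subst ncstar_mat_four_block) (auto simp: ncstar_mat_zero ncstar_mat_dim)

section \<open>Affine polynomials\<close>

text \<open>Affineness as a degree bound on single entries passes through block constructions at
  once; coefficient matrices are extracted only at the end.\<close>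

definition nc_affine :: "nat \<Rightarrow> ncpoly set" where
  "nc_affine d = {p \<in> ncpolys d. \<forall>w \<in> Poly_Mapping.keys p. length w \<le> 1}"

lemma nc_affine_subset_ncpolys: "nc_affine d \<subseteq> ncpolys d"
  by (auto simp: nc_affine_def)

lemma zero_in_ncpolys: "0 \<in> ncpolys d"
  by (simp add: ncpolys_def)

lemma uminus_in_ncpolys: "p \<in> ncpolys d \<Longrightarrow> - p \<in> ncpolys d"
  by (simp add: ncpolys_def)

lemma zero_in_nc_affine: "0 \<in> nc_affine d"
  by (simp add: nc_affine_def zero_in_ncpolys)

lemma one_in_nc_affine: "1 \<in> nc_affine d"
  by (simp add: nc_affine_def one_in_ncpolys zero_list_def)

lemma nc_const_in_nc_affine: "nc_const c \<in> nc_affine d"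
  using nc_const_in_ncpolys[of c d] by (simp add: nc_affine_def) (simp add: nc_const_def)

lemma nc_var_in_nc_affine: "i \<in> {1..d} \<Longrightarrow> nc_var i \<in> nc_affine d"
  using nc_var_in_ncpolys[of i d] by (simp add: nc_affine_def) (simp add: nc_var_def)

lemma uminus_in_nc_affine: "p \<in> nc_affine d \<Longrightarrow> - p \<in> nc_affine d"
  by (simp add: nc_affine_def uminus_in_ncpolys)

lemma ncstar_in_nc_affine: "p \<in> nc_affine d \<Longrightarrow> ncstar p \<in> nc_affine d"
  using ncstar_in_ncpolys[of p d] length_rev
  unfolding nc_affine_def in_keys_iff lookup_ncstar complex_cnj_zero_iff mem_Collect_eq Ball_def
  by metis

lemma uminus_in_mats_over_nc_affine:
  "A \<in> mats_over (nc_affine d) m n \<Longrightarrow> - A \<in> mats_over (nc_affine d) m n"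
  by (auto simp: mats_over_iff uminus_in_nc_affine)

lemma nc_const_mult_var: "nc_const c * nc_var k = Poly_Mapping.single [k] c"
  by (simp add: nc_const_def nc_var_def mult_single plus_list_def)

lemma nc_affine_expansion:
  assumes "p \<in> nc_affine d"
  shows "p = nc_const (Poly_Mapping.lookup p []) +
    (\<Sum>k = 1..d. nc_const (Poly_Mapping.lookup p [k]) * nc_var k)"
proof (rule poly_mapping_eqI)
  fix w
  have "Poly_Mapping.lookup p w = 0" if "length w > 1 \<or> \<not> set w \<subseteq> {1..d}"
    using assms that by (force simp: nc_affine_def ncpolys_def in_keys_iff)
  then show "Poly_Mapping.lookup p w = Poly_Mapping.lookup (nc_const (Poly_Mapping.lookup p []) +
    (\<Sum>k = 1..d. nc_const (Poly_Mapping.lookup p [k]) * nc_var k)) w"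
    unfolding nc_const_mult_var
    \<comment> \<open>This case rule splits words into empty, one-letter and longer ones.\<close>
    by (cases w rule: remdups_adj.cases)
       (auto simp: nc_const_def lookup_add lookup_sum lookup_single when_def)
qed

lemma affine_ncmat_if_mats_over_nc_affine:
  assumes "P \<in> mats_over (nc_affine d) n n"
  shows "affine_ncmat d n P"
  unfolding affine_ncmat_def
\<comment> \<open>The coefficient matrices are read off entrywise: index 0 belongs to the empty
  word, index k > 0 to the word \<open>[k]\<close>.\<close>
proof (intro exI[of _ "\<lambda>k. map_mat (\<lambda>p. Poly_Mapping.lookup p (if k = 0 then [] else [k])) P"]
    conjI allI impI)
  show "map_mat (\<lambda>p. Poly_Mapping.lookup p (if k = 0 then [] else [k])) P \<in> carrier_mat n n" for k
    using mats_over_carrier[OF assms] by simp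
  show "P = mat n n (\<lambda>(i, j).
      nc_const (map_mat (\<lambda>p. Poly_Mapping.lookup p (if 0 = (0::nat) then [] else [0])) P $$ (i, j)) +
      (\<Sum>k = 1..d. nc_const
        (map_mat (\<lambda>p. Poly_Mapping.lookup p (if k = 0 then [] else [k])) P $$ (i, j)) * nc_var k))"
    (is "P = ?R")
  proof (rule eq_matI)
    fix i j assume "i < dim_row ?R" "j < dim_col ?R"
    then have ij: "i < n" "j < n" by simp_all
    with assms have "P $$ (i, j) \<in> nc_affine d" by (simp add: mats_over_iff)
    from nc_affine_expansion[OF this] show "P $$ (i, j) = ?R $$ (i, j)"
      using ij mats_over_carrier[OF assms] by (auto intro!: sum.cong)
  qed (use mats_over_carrier[OF assms] in simp_all)
qed

section \<open>Realizations\<close>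

text \<open>The inverse \<open>r\<close> is carried along explicitly. Its entries range over the
  whole algebra, since the inverse of an affine matrix is in general not affine.\<close>

definition realization ::
  "nat \<Rightarrow> ncpoly \<Rightarrow> nat \<Rightarrow> ncpoly mat \<Rightarrow> ncpoly mat \<Rightarrow> ncpoly mat \<Rightarrow> ncpoly mat \<Rightarrow> bool" where
  "realization d p m u q r v \<longleftrightarrow>
     u \<in> mats_over (nc_affine d) 1 m \<and> q \<in> mats_over (nc_affine d) m m \<and>
     v \<in> mats_over (nc_affine d) m 1 \<and> r \<in> mats_over (ncpolys d) m m \<and>
     q * r = 1\<^sub>m m \<and> r * q = 1\<^sub>m m \<and> u * r * v = mat 1 1 (\<lambda>_. p)"

lemma is_linearization_if_realization:
  assumes "realization d (- p) m u q r v"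
  shows "is_linearization d p (four_block_mat (0\<^sub>m 1 1) u v q)"
proof -
  have m: "u \<in> mats_over (nc_affine d) 1 m" "q \<in> mats_over (nc_affine d) m m"
     "v \<in> mats_over (nc_affine d) m 1" "r \<in> mats_over (ncpolys d) m m"
    and inv: "q * r = 1\<^sub>m m" "r * q = 1\<^sub>m m" and p: "u * r * v = mat 1 1 (\<lambda>_. - p)"
    using assms by (simp_all add: realization_def)
  have P: "four_block_mat (0\<^sub>m 1 1) u v q \<in> mats_over (nc_affine d) (1 + m) (1 + m)"
    using m by (intro four_block_in_mats_over zero_in_mats_over zero_in_nc_affine)
  show ?thesis
    unfolding is_linearization_def ncmats_eq_mats_over
    using m[THEN mats_over_carrier] P[THEN mats_over_mono, OF nc_affine_subset_ncpolys]
      m(1-3)[THEN mats_over_mono, OF nc_affine_subset_ncpolys] m(4)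
      affine_ncmat_if_mats_over_nc_affine[OF P]
    by (intro exI[of _ "1 + m"] exI[of _ u] exI[of _ v] exI[of _ q] exI[of _ r])
       (simp add: inverts_mat_def p inv)
qed

lemma realization_const:
  "realization d (nc_const c) 1 (mat 1 1 (\<lambda>_. nc_const c)) (1\<^sub>m 1) (1\<^sub>m 1) (1\<^sub>m 1)"
  unfolding realization_def
  by (auto intro!: one_in_mats_over zero_in_nc_affine one_in_nc_affine zero_in_ncpolys
      one_in_ncpolys simp: mats_over_iff nc_const_in_nc_affine)

text \<open>The zero off-diagonal blocks of the inverse remove the mixed terms, so the two values
  add up.\<close>

lemma realization_add:
  assumes "realization d p1 m1 u1 q1 r1 v1" "realization d p2 m2 u2 q2 r2 v2"
  shows "realization d (p1 + p2) (m1 + m2) (block_row u1 u2)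
    (four_block_mat q1 (0\<^sub>m m1 m2) (0\<^sub>m m2 m1) q2)
    (four_block_mat r1 (0\<^sub>m m1 m2) (0\<^sub>m m2 m1) r2) (v1 @\<^sub>r v2)"
proof -
  have m: "u1 \<in> mats_over (nc_affine d) 1 m1" "q1 \<in> mats_over (nc_affine d) m1 m1"
     "v1 \<in> mats_over (nc_affine d) m1 1" "r1 \<in> mats_over (ncpolys d) m1 m1"
     "u2 \<in> mats_over (nc_affine d) 1 m2" "q2 \<in> mats_over (nc_affine d) m2 m2"
     "v2 \<in> mats_over (nc_affine d) m2 1" "r2 \<in> mats_over (ncpolys d) m2 m2"
    and inv: "q1 * r1 = 1\<^sub>m m1" "r1 * q1 = 1\<^sub>m m1" "q2 * r2 = 1\<^sub>m m2" "r2 * q2 = 1\<^sub>m m2"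
    and p: "u1 * r1 * v1 = mat 1 1 (\<lambda>_. p1)" "u2 * r2 * v2 = mat 1 1 (\<lambda>_. p2)"
    using assms by (simp_all add: realization_def)
  note c = m[THEN mats_over_carrier]
  have ur: "u1 * r1 \<in> carrier_mat 1 m1" "u2 * r2 \<in> carrier_mat 1 m2" using c by auto
  have "four_block_mat q1 (0\<^sub>m m1 m2) (0\<^sub>m m2 m1) q2 *
      four_block_mat r1 (0\<^sub>m m1 m2) (0\<^sub>m m2 m1) r2 = 1\<^sub>m (m1 + m2)"
    "four_block_mat r1 (0\<^sub>m m1 m2) (0\<^sub>m m2 m1) r2 *
      four_block_mat q1 (0\<^sub>m m1 m2) (0\<^sub>m m2 m1) q2 = 1\<^sub>m (m1 + m2)"
    using c by (simp_all add: mult_four_block_mat[of _ m1 m1 _ m2 _ m2 _ _ m1 _ m2] inv)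
  moreover have "block_row u1 u2 * four_block_mat r1 (0\<^sub>m m1 m2) (0\<^sub>m m2 m1) r2 * (v1 @\<^sub>r v2) =
      mat 1 1 (\<lambda>_. p1 + p2)"
    using c ur by
      (simp add: block_row_mult_append_rows[of _ 1 m1 _ m2 _ m1 _ m2 _ _ _ 1] p) auto
  ultimately show ?thesis
    unfolding realization_def
    using m by (auto intro!: four_block_in_mats_over block_row_in_mats_over
        append_rows_in_mats_over zero_in_mats_over zero_in_nc_affine zero_in_ncpolys)
qed

text \<open>The row selects x times the first row \<open>(1, u * r)\<close> of the inverse, and the
  column turns this into \<open>x * (u * r * v)\<close>. Since \<open>x\<close> and \<open>u\<close>
  sit in different blocks and are never multiplied in the data, affineness survives.\<close>

lemma realization_affine_mult:
  assumes "realization d p m u q r v" and x: "x \<in> nc_affine d"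
  shows "realization d (x * p) (1 + m) (block_row (mat 1 1 (\<lambda>_. x)) (0\<^sub>m 1 m))
    (four_block_mat (1\<^sub>m 1) (- u) (0\<^sub>m m 1) q) (four_block_mat (1\<^sub>m 1) (u * r) (0\<^sub>m m 1) r)
    (0\<^sub>m 1 1 @\<^sub>r v)"
proof -
  have m: "u \<in> mats_over (nc_affine d) 1 m" "q \<in> mats_over (nc_affine d) m m"
     "v \<in> mats_over (nc_affine d) m 1" "r \<in> mats_over (ncpolys d) m m"
    and inv: "q * r = 1\<^sub>m m" "r * q = 1\<^sub>m m" and p: "u * r * v = mat 1 1 (\<lambda>_. p)"
    using assms by (simp_all add: realization_def)
  note c = m[THEN mats_over_carrier]
  have ur: "u * r \<in> mats_over (ncpolys d) 1 m"
    by (rule mult_in_mats_over[OF mats_over_mono[OF m(1) nc_affine_subset_ncpolys] m(4)])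
       (auto intro: zero_in_ncpolys add_in_ncpolys mult_in_ncpolys)
  note urc = mats_over_carrier[OF ur]
  have x_row: "mat 1 1 (\<lambda>_. x) \<in> mats_over (nc_affine d) 1 1"
    using x by (simp add: mats_over_iff)
  \<comment> \<open>For the left inverse the upper right block is \<open>- u + u * r * q\<close>,
    which vanishes by this identity.\<close>
  have urq: "u * r * q = u" using c by (simp add: assoc_mult_mat[of _ 1 m _ m _ m] inv)
  have ur0: "- (u * r) + u * r = 0\<^sub>m 1 m" "u * r + - (u * r) = 0\<^sub>m 1 m"
    and u0: "- u + u = 0\<^sub>m 1 m" and neg0: "- 0\<^sub>m m m = (0\<^sub>m m m :: ncpoly mat)"
    using c urc by (auto intro!: eq_matI)
  have "four_block_mat (1\<^sub>m 1) (- u) (0\<^sub>m m 1) q *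
      four_block_mat (1\<^sub>m 1) (u * r) (0\<^sub>m m 1) r = 1\<^sub>m (1 + m)"
    using c urc by (subst mult_four_block_mat[of _ 1 1 _ m _ m _ _ 1 _ m])
       (auto simp: inv ur0 simp del: One_nat_def)
  moreover have "four_block_mat (1\<^sub>m 1) (u * r) (0\<^sub>m m 1) r *
      four_block_mat (1\<^sub>m 1) (- u) (0\<^sub>m m 1) q = 1\<^sub>m (1 + m)"
    using c urc by (subst mult_four_block_mat[of _ 1 1 _ m _ m _ _ 1 _ m])
       (auto simp: inv urq u0 neg0 simp del: One_nat_def)
  moreover have "block_row (mat 1 1 (\<lambda>_. x)) (0\<^sub>m 1 m) *
      four_block_mat (1\<^sub>m 1) (u * r) (0\<^sub>m m 1) r * (0\<^sub>m 1 1 @\<^sub>r v) = mat 1 1 (\<lambda>_. x * p)"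
  proof -
    let ?X = "mat 1 1 (\<lambda>_. x)"
    have Xur: "?X * (u * r) \<in> carrier_mat 1 m" "?X * (u * r) * v \<in> carrier_mat 1 1"
      using c urc by (auto intro!: mult_carrier_mat)
    have "block_row ?X (0\<^sub>m 1 m) * four_block_mat (1\<^sub>m 1) (u * r) (0\<^sub>m m 1) r * (0\<^sub>m 1 1 @\<^sub>r v) =
        (?X * 1\<^sub>m 1 + 0\<^sub>m 1 m * 0\<^sub>m m 1) * 0\<^sub>m 1 1 + (?X * (u * r) + 0\<^sub>m 1 m * r) * v"
      using c urc by (intro block_row_mult_append_rows) auto
    also have "\<dots> = ?X * (u * r) * v" using c Xur by (simp del: One_nat_def)
    also have "\<dots> = ?X * (u * r * v)" using c urc by (intro assoc_mult_mat) auto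
    also have "\<dots> = mat 1 1 (\<lambda>_. x * p)"
      unfolding p by (intro eq_matI) (auto simp: scalar_prod_def)
    finally show ?thesis .
  qed
  ultimately show ?thesis
    unfolding realization_def
    using m ur x_row uminus_in_mats_over_nc_affine[OF m(1)]
    by (intro conjI four_block_in_mats_over block_row_in_mats_over append_rows_in_mats_over
        zero_in_mats_over one_in_mats_over zero_in_nc_affine zero_in_ncpolys one_in_nc_affine
        one_in_ncpolys)
qed

text \<open>The row times the antidiagonal inverse is \<open>(v\<^sup>* r\<^sup>*, u r)\<close>, and
  the column completes this to \<open>v\<^sup>* r\<^sup>* u\<^sup>* + u r v\<close>, whose first
  summand is the adjoint of the second.\<close>

lemma realization_ncstar:
  assumes "realization d p m u q r v"
  shows "realization d (p + ncstar p) (m + m) (block_row u (ncstar_mat v))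
    (four_block_mat (0\<^sub>m m m) (ncstar_mat q) q (0\<^sub>m m m))
    (four_block_mat (0\<^sub>m m m) r (ncstar_mat r) (0\<^sub>m m m)) (ncstar_mat u @\<^sub>r v)"
proof -
  have m: "u \<in> mats_over (nc_affine d) 1 m" "q \<in> mats_over (nc_affine d) m m"
     "v \<in> mats_over (nc_affine d) m 1" "r \<in> mats_over (ncpolys d) m m"
    and inv: "q * r = 1\<^sub>m m" "r * q = 1\<^sub>m m" and p: "u * r * v = mat 1 1 (\<lambda>_. p)"
    using assms by (simp_all add: realization_def)
  note c = m[THEN mats_over_carrier] m[THEN mats_over_carrier, THEN ncstar_mat_carrier]
  note star = m(1-3)[THEN ncstar_mat_in_mats_over, OF ncstar_in_nc_affine]
    m(4)[THEN ncstar_mat_in_mats_over, OF ncstar_in_ncpolys]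
  \<comment> \<open>Adjoints of \<open>r * q = 1\<close> and \<open>q * r = 1\<close>, with the
    factors reversed.\<close>
  have star_inv: "ncstar_mat q * ncstar_mat r = 1\<^sub>m m" "ncstar_mat r * ncstar_mat q = 1\<^sub>m m"
    using c inv by (simp_all add: ncstar_mat_one flip: ncstar_mat_mult)
  have ur: "u * r \<in> carrier_mat 1 m" "ncstar_mat v * ncstar_mat r \<in> carrier_mat 1 m"
    using c by auto
  have "ncstar_mat v * ncstar_mat r * ncstar_mat u = ncstar_mat (u * r * v)"
    using c ur by (simp add: ncstar_mat_mult assoc_mult_mat[of _ 1 m _ m _ 1])
  also have "\<dots> = mat 1 1 (\<lambda>_. ncstar p)"
    unfolding p by (intro eq_matI) (auto simp: ncstar_mat_dim ncstar_mat_index)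
  finally have star_p: "ncstar_mat v * ncstar_mat r * ncstar_mat u = mat 1 1 (\<lambda>_. ncstar p)" .
  have "four_block_mat (0\<^sub>m m m) (ncstar_mat q) q (0\<^sub>m m m) *
      four_block_mat (0\<^sub>m m m) r (ncstar_mat r) (0\<^sub>m m m) = 1\<^sub>m (m + m)"
    "four_block_mat (0\<^sub>m m m) r (ncstar_mat r) (0\<^sub>m m m) *
      four_block_mat (0\<^sub>m m m) (ncstar_mat q) q (0\<^sub>m m m) = 1\<^sub>m (m + m)"
    using c by (simp_all add: mult_four_block_mat[of _ m m _ m _ m _ _ m _ m] inv star_inv)
  moreover have "block_row u (ncstar_mat v) * four_block_mat (0\<^sub>m m m) r (ncstar_mat r) (0\<^sub>m m m) *
      (ncstar_mat u @\<^sub>r v) = mat 1 1 (\<lambda>_. p + ncstar p)"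
    using c ur by
      (simp add: block_row_mult_append_rows[of _ 1 m _ m _ m _ m _ _ _ 1] p star_p) auto
  ultimately show ?thesis
    unfolding realization_def
    using m star by (auto intro!: four_block_in_mats_over block_row_in_mats_over
        append_rows_in_mats_over zero_in_mats_over zero_in_nc_affine zero_in_ncpolys)
qed

text \<open>The empty word carries the coefficient as a constant; each letter is then multiplied on
  from the left.\<close>

lemma ex_realization_single:
  assumes "set w \<subseteq> {1..d}"
  shows "\<exists>m u q r v. realization d (Poly_Mapping.single w c) m u q r v"
  using assms
proof (induction w)
  case Nil
  show ?case using realization_const[of d c] unfolding nc_const_def by blast
next
  case (Cons k w)
  then obtain m u q r v where "realization d (Poly_Mapping.single w c) m u q r v" by auto
  from realization_affine_mult[OF this nc_var_in_nc_affine[of k]] Cons.prems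
  have "\<exists>m u q r v. realization d (nc_var k * Poly_Mapping.single w c) m u q r v" by (simp, blast)
  then show ?case by (simp add: nc_var_def mult_single plus_list_def)
qed

lemma ex_realization:
  assumes "p \<in> ncpolys d"
  shows "\<exists>m u q r v. realization d p m u q r v"
proof -
  \<comment> \<open>Freeing the index set and the coefficients from \<open>p\<close> makes induction
    on the set of words possible.\<close>
  have "\<exists>m u q r v. realization d (\<Sum>w\<in>W. Poly_Mapping.single w (f w)) m u q r v"
    if "finite W" "\<And>w. w \<in> W \<Longrightarrow> set w \<subseteq> {1..d}" for W f
    using that
  proof (induction W)
    case empty
    \<comment> \<open>The empty sum is the constant 0.\<close>
    show ?case using realization_const[of d 0] unfolding nc_const_def by (simp, blast)
  next
    case (insert w W)
    from insert.IH insert.prems obtain m1 u1 q1 r1 v1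
      where "realization d (\<Sum>w\<in>W. Poly_Mapping.single w (f w)) m1 u1 q1 r1 v1" by blast
    moreover from ex_realization_single[of w d "f w"] insert.prems obtain m2 u2 q2 r2 v2
      where "realization d (Poly_Mapping.single w (f w)) m2 u2 q2 r2 v2" by blast
    ultimately show ?case
      using realization_add insert.hyps unfolding sum.insert[OF insert.hyps] by blast
  qed
  from this[of "Poly_Mapping.keys p" "Poly_Mapping.lookup p"] assms show ?thesis
    by (simp add: ncpolys_def flip: ncpoly_sum_single)
qed

theorem theorem8p5:
  fixes d :: nat and p :: ncpoly
  assumes "p \<in> ncpolys d"
  shows "(\<exists>P. is_linearization d p P) \<and>
         (p = ncstar p \<longrightarrow> (\<exists>P. is_linearization d p P \<and> P = ncstar_mat P))"
proof (intro conjI impI)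
  show "\<exists>P. is_linearization d p P"
    using ex_realization[OF uminus_in_ncpolys[OF assms]]
    by (blast intro: is_linearization_if_realization)
next
  assume self: "p = ncstar p"
  \<comment> \<open>The factor halves \<open>p\<close> because \<open>h\<close> and its adjoint will
    both contribute, and its sign is the one in \<open>- u q\<^sup>-\<^sup>1 v\<close>.\<close>
  define h where "h = nc_const (- 1 / 2) * p"
  have "ncstar h = p * nc_const (- 1 / 2)"
    unfolding h_def ncstar_mult ncstar_const using self by simp
  \<comment> \<open>Scalars are central: this is checked on monomials, where both products keep the
    word and multiply coefficients in the commutative field.\<close>
  also have "\<dots> = h"
    unfolding h_def nc_const_def
    by (subst (1 2) ncpoly_sum_single[of p])
       (simp add: sum_distrib_left sum_distrib_right mult_single plus_list_def mult.commute)
  finally have "h + ncstar h = nc_const (- 1) * p"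
    by (simp add: h_def nc_const_def flip: distrib_right single_add)
  also have "\<dots> = - p"
    by (simp add: nc_const_def single_uminus flip: zero_list_def)
  finally have h: "h + ncstar h = - p" .
  have "h \<in> ncpolys d"
    unfolding h_def by (intro mult_in_ncpolys nc_const_in_ncpolys assms)
  then obtain m u q r v where R: "realization d h m u q r v"
    using ex_realization by blast
  then have c: "u \<in> carrier_mat 1 m" "q \<in> carrier_mat m m" "v \<in> carrier_mat m 1"
    unfolding realization_def by (blast intro: mats_over_carrier)+
  let ?u = "block_row u (ncstar_mat v)" and ?v = "ncstar_mat u @\<^sub>r v"
    and ?q = "four_block_mat (0\<^sub>m m m) (ncstar_mat q) q (0\<^sub>m m m)"
  have R': "realization d (- p) (m + m) ?u ?q
      (four_block_mat (0\<^sub>m m m) r (ncstar_mat r) (0\<^sub>m m m)) ?v"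
    using realization_ncstar[OF R] unfolding h .
  then have c': "?u \<in> carrier_mat 1 (m + m)" "?q \<in> carrier_mat (m + m) (m + m)"
    "?v \<in> carrier_mat (m + m) 1"
    unfolding realization_def by (blast intro: mats_over_carrier)+
  \<comment> \<open>Adjunction exchanges the row and the column, and it fixes \<open>?q\<close>
    because its two antidiagonal blocks are adjoint to each other. Hence the bordered matrix is
    selfadjoint.\<close>
  have "ncstar_mat ?u = ?v" "ncstar_mat ?v = ?u" "ncstar_mat ?q = ?q"
    using c c[THEN ncstar_mat_carrier]
    by (simp_all add: ncstar_mat_block_row[of _ 1 m _ m] ncstar_mat_append_rows[of _ m 1 _ m]
        ncstar_mat_four_block[of _ m m _ m _ m] ncstar_mat_ncstar_mat ncstar_mat_zero)
  then have "ncstar_mat (four_block_mat (0\<^sub>m 1 1) ?u ?v ?q) = four_block_mat (0\<^sub>m 1 1) ?u ?v ?q"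
    using c' by (subst ncstar_mat_four_block[of _ 1 1]) (auto simp: ncstar_mat_zero)
  with is_linearization_if_realization[OF R']
  show "\<exists>P. is_linearization d p P \<and> P = ncstar_mat P" by metis
qed

end
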